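(* Let $\mathcal X$ be an RD-space, let $\rho$ be an admissible function on $\mathcal X$, and let $K_\rho:\mathcal X\times\mathcal X\to[0,\infty)$ be a measurable kernel for which there is a positive constant $C_5$ such that, for all $x,y\in\mathcal X$: (K)$_1$ $K_\rho(x,y)=0$ if $d(x,y)>C_5\min\{\rho(x),\rho(y)\}$; (K)$_2$ $K_\rho(x,y)\le C_5\frac1{\mu(B(x,\rho(x)))+\mu(B(y,\rho(y)))}$; (K)$_3$ $K_\rho(x,y)=K_\rho(y,x)$; (K)$_4$ $\int_{\mathcal X}K_\rho(x,y)\,d\mu(x)=1$ for all $y$. Put $K_\rho(f)(x)=\int_{\mathcal X}K_\rho(x,y)f(y)\,d\mu(y)$. Then there exists a positive constant $C$ such that for all $f\in\mathrm{BLO}(\mathcal X)$, $f-K_\rho(f)\in\mathrm{BLO}_\rho(\mathcal X)$ and $$\|f-K_\rho(f)\|_{\mathrm{BLO}_\rho(\mathcal X)}\le C\|f\|_{\mathrm{BLO}(\mathcal X)}.$$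
   Context: RD-space: $(\mathcal X,d)$ is a metric space with a regular Borel measure $\mu$ such that all balls $B(x,r)=\{y: d(x,y)<r\}$ have finite and positive measure; $\mu$ is doubling, i.e. there is $A_1\ge1$ with $\mu(B(x,2r))\le A_1\mu(B(x,r))$ for all $x\in\mathcal X$, $r>0$; and there are $0<\kappa\le n$, $A_2\in(0,1]$, $A_3\in[1,\infty)$ such that $A_2\lambda^\kappa\mu(B(x,r))\le\mu(B(x,\lambda r))\le A_3\lambda^n\mu(B(x,r))$ for all $x\in\mathcal X$, $0<r\le \mathrm{diam}(\mathcal X)/2$ and $1\le\lambda\le \mathrm{diam}(\mathcal X)/(2r)$. Balls are understood together with their center and radius. Admissible function: $\rho:\mathcal X\to(0,\infty)$ is admissible if there are positive constants $C_0,k_0$ such that $\frac1{\rho(x)}\le C_0\frac1{\rho(y)}\left(1+\frac{d(x,y)}{\rho(y)}\right)^{k_0}$ for all $x,y\in\mathcal X$. Functions here are real-valued; $L^1_{\rm loc}(\mathcal X)$ means integrable on every ball. Let $\mathcal D$ be the collection of balls $B(x,r)$ with $r\ge\rho(x)$. The spaces consist of the $f\in L^1_{\rm loc}(\mathcal X)$ for which the following are finite: $$\|f\|_{\mathrm{BLO}(\mathcal X)}=\sup_{B\subset\mathcal X}\frac1{\mu(B)}\int_B\left[f-\operatorname*{ess\,inf}_B f\right]d\mu,$$ $$\|f\|_{\mathrm{BLO}_\rho(\mathcal X)}=\sup_{B\notin\mathcal D}\frac1{\mu(B)}\int_B\left[f-\operatorname*{ess\,inf}_B f\right]d\mu+\sup_{B\in\mathcal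 D}\frac1{\mu(B)}\int_B|f|\,d\mu.$$ *)

theory Defs
  imports "HOL-Probability.Essential_Supremum"
begin

text \<open>Extended-real diameter of the whole space: the library's \<open>diameter\<close> is real-valued and
  carries no information for unbounded sets.\<close>

definition space_diam :: "'a::metric_space itself \<Rightarrow> ereal" where
  "space_diam _ = (SUP x::'a. SUP y::'a. ereal (dist x y))"

text \<open>Regularity of a Borel measure on a metric space is taken in Parthasarathy's sense
  (approximation by open sets from outside and by closed sets from inside).  Inner approximation by
  compact sets implies it, so results for this class cover the stricter convention as well.\<close>

definition regular_borel_measure :: "'a::topological_space measure \<Rightarrow> bool" where
  "regular_borel_measure \<mu> \<longleftrightarrow>
     sets \<mu> = sets borel \<and>
     (\<forall>E\<in>sets \<mu>.
        emeasure \<mu> E = (INF U\<in>{U. open U \<and> E \<subseteq> U}. emeasure \<mu> U) \<and>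
        emeasure \<mu> E = (SUP F\<in>{F. closed F \<and> F \<subseteq> E}. emeasure \<mu> F))"

definition doubling :: "'a::metric_space measure \<Rightarrow> bool" where
  "doubling \<mu> \<longleftrightarrow>
     (\<exists>A1\<ge>1. \<forall>x. \<forall>r>0. measure \<mu> (ball x (2 * r)) \<le> A1 * measure \<mu> (ball x r))"

definition RD_space :: "'a::metric_space measure \<Rightarrow> bool" where
  "RD_space \<mu> \<longleftrightarrow>
     regular_borel_measure \<mu> \<and>
     (\<forall>x. \<forall>r>0. 0 < emeasure \<mu> (ball x r) \<and> emeasure \<mu> (ball x r) < \<infinity>) \<and>
     doubling \<mu> \<and>
     (\<exists>\<kappa> n A2 A3 :: real. 0 < \<kappa> \<and> \<kappa> \<le> n \<and> 0 < A2 \<and> A2 \<le> 1 \<and> 1 \<le> A3 \<and>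
        (\<forall>x r l. 0 < r \<and> ereal r \<le> space_diam TYPE('a) / 2 \<and>
                 1 \<le> l \<and> ereal l \<le> space_diam TYPE('a) / ereal (2 * r) \<longrightarrow>
           A2 * l powr \<kappa> * measure \<mu> (ball x r) \<le> measure \<mu> (ball x (l * r)) \<and>
           measure \<mu> (ball x (l * r)) \<le> A3 * l powr n * measure \<mu> (ball x r)))"

definition admissible :: "('a::metric_space \<Rightarrow> real) \<Rightarrow> bool" where
  "admissible \<rho> \<longleftrightarrow>
     (\<forall>x. 0 < \<rho> x) \<and>
     (\<exists>C0 k0. 0 < C0 \<and> 0 < k0 \<and>
        (\<forall>x y. 1 / \<rho> x \<le> C0 * (1 / \<rho> y) * (1 + dist x y / \<rho> y) powr k0))"

definition L1_loc :: "'a::metric_space measure \<Rightarrow> ('a \<Rightarrow> real) set" where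
  "L1_loc \<mu> = {f. \<forall>x. \<forall>r>0. set_integrable \<mu> (ball x r) f}"

text \<open>Balls are handled as pairs of a centre and a radius, since membership in \<open>\<D>\<close> depends
  on both and not only on the underlying point set.\<close>

definition balls :: "('a::metric_space \<times> real) set" where
  "balls = {(x, r). 0 < r}"

definition large_balls :: "('a::metric_space \<Rightarrow> real) \<Rightarrow> ('a \<times> real) set" where
  "large_balls \<rho> = {(x, r) \<in> balls. \<rho> x \<le> r}"

definition essinf_on :: "'a measure \<Rightarrow> 'a set \<Rightarrow> ('a \<Rightarrow> real) \<Rightarrow> ereal" where
  "essinf_on \<mu> B f = - esssup (restrict_space \<mu> B) (\<lambda>x. - ereal (f x))"

text \<open>Both averages below take values in \<open>[0, \<infinity>]\<close>.  The integrand of \<open>lower_osc\<close> is non-negative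
  almost everywhere on \<open>B\<close>, so \<open>e2ennreal\<close> truncates only on a null set; if the essential infimum
  is \<open>-\<infinity>\<close>, the integrand is \<open>\<infinity>\<close> on \<open>B\<close>.\<close>

definition lower_osc :: "'a measure \<Rightarrow> 'a set \<Rightarrow> ('a \<Rightarrow> real) \<Rightarrow> ennreal" where
  "lower_osc \<mu> B f =
     (\<integral>\<^sup>+x\<in>B. e2ennreal (ereal (f x) - essinf_on \<mu> B f) \<partial>\<mu>) / emeasure \<mu> B"

definition mean_abs :: "'a measure \<Rightarrow> 'a set \<Rightarrow> ('a \<Rightarrow> real) \<Rightarrow> ennreal" where
  "mean_abs \<mu> B f = (\<integral>\<^sup>+x\<in>B. ennreal \<bar>f x\<bar> \<partial>\<mu>) / emeasure \<mu> B"

definition BLO_norm :: "'a::metric_space measure \<Rightarrow> ('a \<Rightarrow> real) \<Rightarrow> ennreal" where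
  "BLO_norm \<mu> f = (SUP (x, r)\<in>balls. lower_osc \<mu> (ball x r) f)"

definition BLO :: "'a::metric_space measure \<Rightarrow> ('a \<Rightarrow> real) set" where
  "BLO \<mu> = {f \<in> L1_loc \<mu>. BLO_norm \<mu> f < \<infinity>}"

definition BLO_rho_norm ::
    "'a::metric_space measure \<Rightarrow> ('a \<Rightarrow> real) \<Rightarrow> ('a \<Rightarrow> real) \<Rightarrow> ennreal" where
  "BLO_rho_norm \<mu> \<rho> f =
     (SUP (x, r)\<in>balls - large_balls \<rho>. lower_osc \<mu> (ball x r) f) +
     (SUP (x, r)\<in>large_balls \<rho>. mean_abs \<mu> (ball x r) f)"

definition BLO_rho :: "'a::metric_space measure \<Rightarrow> ('a \<Rightarrow> real) \<Rightarrow> ('a \<Rightarrow> real) set" where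
  "BLO_rho \<mu> \<rho> = {f \<in> L1_loc \<mu>. BLO_rho_norm \<mu> \<rho> f < \<infinity>}"

definition kernel_op :: "'a measure \<Rightarrow> ('a \<Rightarrow> 'a \<Rightarrow> real) \<Rightarrow> ('a \<Rightarrow> real) \<Rightarrow> 'a \<Rightarrow> real" where
  "kernel_op \<mu> K f x = (\<integral>y. K x y * f y \<partial>\<mu>)"

end

theory Submission
  imports Defs
begin

text \<open>Write \<open>N\<close> for the BLO norm of \<open>f\<close> and \<open>Kf\<close> for \<open>kernel_op \<mu> K f\<close>.  Everything rests on one
  local estimate (\<open>kernel_op_near_essinf\<close>).  On a critical ball \<open>B(z, L \<rho>(z))\<close> all values of \<open>\<rho>\<close> are
  comparable, so the sections \<open>K x\<close> with \<open>x\<close> in that ball are probability densities which live on a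
  common larger ball \<open>B' = B(z, R \<rho>(z))\<close> and are bounded there by a multiple of \<open>1 / \<mu>(B')\<close>.
  If \<open>m\<close> is the essential infimum of \<open>f\<close> on \<open>B'\<close>, then \<open>Kf(x) - m = \<integral> K(x, y) (f(y) - m) dy\<close> is
  non-negative and at most a multiple of the mean of \<open>f - m\<close> on \<open>B'\<close>, hence of \<open>N\<close>.  Thus \<open>Kf\<close> is
  constant on critical balls up to an error \<open>O(N)\<close>, and this constant
  bounds \<open>f\<close> from below almost everywhere.

  On a ball \<open>B(x, r)\<close> with \<open>r < \<rho>(x)\<close>, subtracting a function that is constant up to \<open>O(N)\<close> changes
  the lower oscillation by \<open>O(N)\<close> at most (\<open>lower_osc_small_ball\<close>).  On a critical ball,
  \<open>|f - Kf| \<le> (f - m) + (Kf - m)\<close> has mean \<open>O(N)\<close> (\<open>critical_ball_integral\<close>).  A ball \<open>B(x, r)\<close> with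
  \<open>r \<ge> \<rho>(x)\<close> is covered by finitely many critical balls of total measure \<open>O(\<mu>(B(x, r)))\<close>: dilate a
  maximal family of disjoint balls \<open>B(z, \<rho>(z))\<close> with centres in \<open>B(x, r)\<close> (\<open>critical_covering\<close>).
  Summing over the cover bounds the mean of \<open>|f - Kf|\<close> on large balls.  All comparisons between
  measures of balls come from iterated doubling (\<open>measure_ball_dilation\<close>).\<close>

section \<open>Critical radii\<close>

lemma ball_subset_ballI:
  fixes x y :: "'a::metric_space"
  assumes "dist x y + r \<le> s"
  shows "ball x r \<subseteq> ball y s"
proof
  fix w assume "w \<in> ball x r"
  thus "w \<in> ball y s" using dist_triangle[of y w x] assms by (simp add: dist_commute)
qed

lemma admissible_pos: "admissible \<rho> \<Longrightarrow> 0 < \<rho> x"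
  by (simp add: admissible_def)

text \<open>Admissibility bounds \<open>\<rho> y\<close> by a multiple of \<open>\<rho> x\<close> when the distance is measured in units of
  \<open>\<rho> y\<close>.  Applied to the pair in one order it gives the first inequality; this converts a distance
  bound in units of \<open>\<rho> x\<close> into one in units of \<open>\<rho> y\<close>, and the other order gives the second.\<close>

lemma admissible_comparable:
  assumes adm: "admissible \<rho>"
  shows "\<exists>M\<ge>1. \<forall>x y. dist x y \<le> L * \<rho> x \<longrightarrow> \<rho> x \<le> M * \<rho> y \<and> \<rho> y \<le> M * \<rho> x"
proof -
  from adm obtain C0 k0 where C0: "0 < C0" and k0: "0 < k0"
    and le: "\<And>x y. 1 / \<rho> x \<le> C0 * (1 / \<rho> y) * (1 + dist x y / \<rho> y) powr k0"
    unfolding admissible_def by blast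
  note pos = admissible_pos[OF adm]
  have step: "\<rho> y \<le> (C0 * (1 + T) powr k0) * \<rho> x" if "dist x y \<le> T * \<rho> y" for x y T
  proof -
    have "dist x y / \<rho> y \<le> T" using that pos[of y] by (simp add: field_simps)
    hence "(1 + dist x y / \<rho> y) powr k0 \<le> (1 + T) powr k0"
      using k0 pos[of y] by (intro powr_mono2) (auto intro!: add_nonneg_nonneg divide_nonneg_pos)
    hence "C0 * (1 / \<rho> y) * (1 + dist x y / \<rho> y) powr k0 \<le> C0 * (1 / \<rho> y) * (1 + T) powr k0"
      using C0 pos[of y] by (intro mult_left_mono) auto
    with le[of x y] have "1 / \<rho> x \<le> C0 * (1 / \<rho> y) * (1 + T) powr k0" by linarith
    thus ?thesis using pos[of x] pos[of y] by (simp add: field_simps)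
  qed
  define M1 where "M1 = C0 * (1 + L) powr k0"
  define M2 where "M2 = C0 * (1 + L * M1) powr k0"
  define M where "M = max 1 (max M1 M2)"
  have bd: "\<rho> x \<le> M * \<rho> y \<and> \<rho> y \<le> M * \<rho> x" if d: "dist x y \<le> L * \<rho> x" for x y
  proof -
    have L0: "0 \<le> L"
      using d pos[of x] zero_le_dist[of x y] by (meson order_trans zero_le_mult_iff not_le)
    have a: "\<rho> x \<le> M1 * \<rho> y" unfolding M1_def using d by (intro step) (simp add: dist_commute)
    have "L * \<rho> x \<le> L * (M1 * \<rho> y)" using a L0 by (rule mult_left_mono)
    hence "dist x y \<le> (L * M1) * \<rho> y" using d by (simp add: mult.assoc)
    hence b: "\<rho> y \<le> M2 * \<rho> x" unfolding M2_def by (rule step)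
    have "M1 * \<rho> y \<le> M * \<rho> y" "M2 * \<rho> x \<le> M * \<rho> x"
      using pos[of x] pos[of y] by (auto simp: M_def intro!: mult_right_mono)
    with a b show ?thesis by linarith
  qed
  have "1 \<le> M" by (simp add: M_def)
  with bd show ?thesis by blast
qed

text \<open>Either \<open>y\<close> is farther from \<open>x\<close> than \<open>\<rho> y\<close>, or the two radii are comparable.  This keeps the
  critical balls centred in a large ball within a fixed dilate of it.\<close>

lemma admissible_growth:
  assumes adm: "admissible \<rho>"
  shows "\<exists>M\<ge>1. \<forall>x y. \<rho> y \<le> M * max (\<rho> x) (dist x y)"
proof -
  obtain M where M: "M \<ge> 1"
    and cmp: "\<And>x y. dist x y \<le> 1 * \<rho> x \<Longrightarrow> \<rho> x \<le> M * \<rho> y"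
    using admissible_comparable[OF adm, of 1] by blast
  have "\<rho> y \<le> M * max (\<rho> x) (dist x y)" for x y
  proof (cases "dist y x \<le> 1 * \<rho> y")
    case True
    have "M * \<rho> x \<le> M * max (\<rho> x) (dist x y)" using M by (intro mult_left_mono) auto
    with cmp[OF True] show ?thesis by linarith
  next
    case False
    hence "\<rho> y \<le> 1 * max (\<rho> x) (dist x y)" by (auto simp: dist_commute)
    also have "\<dots> \<le> M * max (\<rho> x) (dist x y)"
      using M admissible_pos[OF adm, of x] by (intro mult_right_mono) (auto simp: le_max_iff_disj less_imp_le)
    finally show ?thesis .
  qed
  with M show ?thesis by blast
qed

lemma admissible_locally_bounded_below:
  assumes adm: "admissible \<rho>"
  shows "\<exists>c>0. \<forall>y\<in>ball x r. c \<le> \<rho> y"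
proof -
  obtain M where M: "M \<ge> 1"
    and cmp: "\<And>a y. dist a y \<le> (r / \<rho> x) * \<rho> a \<Longrightarrow> \<rho> a \<le> M * \<rho> y"
    using admissible_comparable[OF adm, of "r / \<rho> x"] by blast
  have "\<rho> x / M \<le> \<rho> y" if "y \<in> ball x r" for y
    using cmp[of x y] that M admissible_pos[OF adm, of x]
    by (simp add: field_simps less_imp_le)
  moreover have "0 < \<rho> x / M" using M admissible_pos[OF adm, of x] by simp
  ultimately show ?thesis by blast
qed

section \<open>Doubling measures\<close>

locale doubling_measure =
  fixes \<mu> :: "'a::metric_space measure"
  assumes sets_eq: "sets \<mu> = sets borel"
    and emeasure_ball: "0 < r \<Longrightarrow> 0 < emeasure \<mu> (ball x r) \<and> emeasure \<mu> (ball x r) < \<infinity>"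
    and doubling: "doubling \<mu>"
begin

lemma space_eq: "space \<mu> = UNIV"
  using sets_eq_imp_space_eq[OF sets_eq] by simp

lemma ball_sets [measurable]: "ball x r \<in> sets \<mu>"
  by (simp add: sets_eq)

lemma ball_finite [simp]: "emeasure \<mu> (ball x r) \<noteq> \<infinity>"
  using emeasure_ball[of r x] by (cases "0 < r") (auto simp: ball_empty)

lemma ball_fmeasurable: "ball x r \<in> fmeasurable \<mu>"
  using ball_finite[of x r] by (intro fmeasurableI) (auto simp: less_top)

lemma emeasure_ball_eq: "emeasure \<mu> (ball x r) = ennreal (measure \<mu> (ball x r))"
  by (rule emeasure_eq_ennreal_measure) (use ball_finite in auto)

lemma measure_ball_pos: "0 < r \<Longrightarrow> 0 < measure \<mu> (ball x r)"
  using emeasure_ball[of r x] by (simp add: emeasure_ball_eq)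

lemma measure_ball_mono: "ball x r \<subseteq> ball y s \<Longrightarrow> measure \<mu> (ball x r) \<le> measure \<mu> (ball y s)"
  by (rule measure_mono_fmeasurable) (auto intro: ball_fmeasurable)

text \<open>Iterated doubling.  Allowing two different centres lets one inclusion of balls
  change both the centre and the scale.\<close>

lemma measure_ball_dilation:
  "\<exists>c\<ge>1. \<forall>x y r s. 0 < r \<longrightarrow> ball x s \<subseteq> ball y (L * r) \<longrightarrow>
     measure \<mu> (ball x s) \<le> c * measure \<mu> (ball y r)"
proof -
  obtain A where A: "A \<ge> 1"
    and dbl: "\<And>x r. 0 < r \<Longrightarrow> measure \<mu> (ball x (2 * r)) \<le> A * measure \<mu> (ball x r)"
    using doubling unfolding doubling_def by blast
  have it: "measure \<mu> (ball y (2 ^ k * r)) \<le> A ^ k * measure \<mu> (ball y r)" if "0 < r" for k y r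
  proof (induction k)
    case (Suc k)
    have "measure \<mu> (ball y (2 * (2 ^ k * r))) \<le> A * measure \<mu> (ball y (2 ^ k * r))"
      using that by (intro dbl) simp
    also have "\<dots> \<le> A * (A ^ k * measure \<mu> (ball y r))"
      using A by (intro mult_left_mono Suc.IH) auto
    finally show ?case by (simp add: mult.assoc)
  qed simp
  obtain k where k: "L < 2 ^ k" using real_arch_pow[of 2 L] by auto
  have "measure \<mu> (ball x s) \<le> A ^ k * measure \<mu> (ball y r)"
    if "0 < r" "ball x s \<subseteq> ball y (L * r)" for x y r s
  proof -
    have "L * r \<le> 2 ^ k * r" using k that by (intro mult_right_mono) auto
    hence "ball x s \<subseteq> ball y (2 ^ k * r)" using that(2) by auto
    thus ?thesis using measure_ball_mono it[OF that(1)] order_trans by blast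
  qed
  moreover have "1 \<le> A ^ k" using A by simp
  ultimately show ?thesis by blast
qed

lemma sigma_finite: "sigma_finite_measure \<mu>"
proof
  have "(\<Union>n::nat. ball undefined (real n)) = (UNIV :: 'a set)"
    using reals_Archimedean2 by auto
  thus "\<exists>A::'a set set. countable A \<and> A \<subseteq> sets \<mu> \<and> \<Union> A = space \<mu> \<and> (\<forall>a\<in>A. emeasure \<mu> a \<noteq> \<infinity>)"
    by (intro exI[of _ "range (\<lambda>n::nat. ball undefined (real n))"]) 
      (use ball_finite in \<open>auto simp: space_eq\<close>)
qed

text \<open>A Vitali covering at the critical scale.  Disjointness of the undilated balls bounds their
  total measure by that of a dilate of the large ball.  Since \<open>\<rho>\<close> is bounded below on the large
  ball, doubling bounds their measures from below, so a disjoint family has boundedly many members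
  and one of maximal cardinality exists.  By maximality each critical ball meets a chosen one,
  and comparability of the radii turns this into membership in a dilate.\<close>

lemma critical_covering:
  assumes adm: "admissible \<rho>"
  shows "\<exists>L>0. \<exists>c\<ge>1. \<forall>x0 r. \<rho> x0 \<le> r \<longrightarrow>
    (\<exists>F. finite F \<and> ball x0 r \<subseteq> (\<Union>z\<in>F. ball z (L * \<rho> z)) \<and>
         (\<Sum>z\<in>F. measure \<mu> (ball z (\<rho> z))) \<le> c * measure \<mu> (ball x0 r))"
proof -
  note pos = admissible_pos[OF adm]
  obtain M where M: "M \<ge> 1"
    and cmp: "\<And>x y. dist x y \<le> 2 * \<rho> x \<Longrightarrow> \<rho> x \<le> M * \<rho> y \<and> \<rho> y \<le> M * \<rho> x"
    using admissible_comparable[OF adm, of 2] by blast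
  obtain G where G: "G \<ge> 1" and growth: "\<And>x y. \<rho> y \<le> G * max (\<rho> x) (dist x y)"
    using admissible_growth[OF adm] by blast
  obtain c where c: "c \<ge> 1"
    and dil: "\<And>x y r s. 0 < r \<Longrightarrow> ball x s \<subseteq> ball y ((1 + G) * r) \<Longrightarrow>
      measure \<mu> (ball x s) \<le> c * measure \<mu> (ball y r)"
    using measure_ball_dilation[of "1 + G"] by blast
  define L where "L = 2 * M + 1"
  have cover: "\<exists>F. finite F \<and> ball x0 r \<subseteq> (\<Union>z\<in>F. ball z (L * \<rho> z)) \<and>
         (\<Sum>z\<in>F. measure \<mu> (ball z (\<rho> z))) \<le> c * measure \<mu> (ball x0 r)"
    if r: "\<rho> x0 \<le> r" for x0 r
  proof -
    have r0: "0 < r" using r pos[of x0] by linarith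
    define adf where "adf F \<longleftrightarrow> finite F \<and> F \<subseteq> ball x0 r \<and>
       disjoint_family_on (\<lambda>z. ball z (\<rho> z)) F" for F
    have inside: "ball z (\<rho> z) \<subseteq> ball x0 ((1 + G) * r)" if "z \<in> ball x0 r" for z
    proof -
      have "\<rho> z \<le> G * max (\<rho> x0) (dist x0 z)" by (rule growth)
      also have "\<dots> \<le> G * r" using that r G by (intro mult_left_mono) auto
      finally have "dist x0 z + \<rho> z \<le> (1 + G) * r" using that by (simp add: algebra_simps)
      thus ?thesis by (intro ball_subset_ballI) (simp add: dist_commute)
    qed
    have sum_le: "(\<Sum>z\<in>F. measure \<mu> (ball z (\<rho> z))) \<le> c * measure \<mu> (ball x0 r)"
      if "adf F" for F
    proof -
      have "(\<Sum>z\<in>F. measure \<mu> (ball z (\<rho> z))) = measure \<mu> (\<Union>z\<in>F. ball z (\<rho> z))"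
        using that unfolding adf_def
        by (intro measure_finite_Union[symmetric]) (use ball_finite in auto)
      also have "\<dots> \<le> measure \<mu> (ball x0 ((1 + G) * r))"
      proof (intro measure_mono_fmeasurable ball_fmeasurable)
        show "(\<Union>z\<in>F. ball z (\<rho> z)) \<subseteq> ball x0 ((1 + G) * r)"
          using that inside unfolding adf_def by blast
        show "(\<Union>z\<in>F. ball z (\<rho> z)) \<in> sets \<mu>"
          using that unfolding adf_def by (intro sets.finite_UN) auto
      qed
      also have "\<dots> \<le> c * measure \<mu> (ball x0 r)" using r0 by (intro dil) auto
      finally show ?thesis .
    qed
    obtain e where e: "e > 0" "\<And>z. z \<in> ball x0 r \<Longrightarrow> e \<le> \<rho> z"
      using admissible_locally_bounded_below[OF adm, of x0 r] by blast
    obtain c' where c': "c' \<ge> 1"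
      and dil': "\<And>x y s t. 0 < s \<Longrightarrow> ball x t \<subseteq> ball y ((2 * r / e) * s) \<Longrightarrow>
        measure \<mu> (ball x t) \<le> c' * measure \<mu> (ball y s)"
      using measure_ball_dilation[of "2 * r / e"] by blast
    have lower: "measure \<mu> (ball x0 r) \<le> c' * measure \<mu> (ball z (\<rho> z))" if z: "z \<in> ball x0 r" for z
    proof (rule dil'[OF pos])
      have "2 * r \<le> 2 * r / e * \<rho> z"
        using e(1) e(2)[OF z] r0 by (simp add: field_simps)
      thus "ball x0 r \<subseteq> ball z (2 * r / e * \<rho> z)"
        using z by (intro ball_subset_ballI) simp
    qed
    have mpos: "0 < measure \<mu> (ball x0 r)" using r0 by (rule measure_ball_pos)
    have card_le: "real (card F) \<le> c * c'" if F: "adf F" for F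
    proof -
      have "real (card F) * measure \<mu> (ball x0 r) = (\<Sum>z\<in>F. measure \<mu> (ball x0 r))" by simp
      also have "\<dots> \<le> (\<Sum>z\<in>F. c' * measure \<mu> (ball z (\<rho> z)))"
        using F unfolding adf_def by (intro sum_mono lower) auto
      also have "\<dots> = c' * (\<Sum>z\<in>F. measure \<mu> (ball z (\<rho> z)))" by (simp add: sum_distrib_left)
      also have "\<dots> \<le> c' * (c * measure \<mu> (ball x0 r))"
        using c' by (intro mult_left_mono sum_le F) auto
      finally have "real (card F) * measure \<mu> (ball x0 r) \<le> (c * c') * measure \<mu> (ball x0 r)"
        by (simp add: ac_simps)
      thus ?thesis using mpos by (simp only: mult_le_cancel_right_pos)
    qed
    have "adf {}" by (simp add: adf_def disjoint_family_on_def)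
    moreover have "\<forall>F. adf F \<longrightarrow> card F \<le> nat \<lceil>c * c'\<rceil>"
      using card_le by (meson of_nat_ceiling order_trans of_nat_le_iff)
    ultimately obtain F where F: "adf F" and maxF: "\<And>F'. adf F' \<Longrightarrow> card F' \<le> card F"
      using ex_has_greatest_nat[of adf "{}" card] by (metis le_imp_less_Suc less_imp_le)
    have covered: "\<exists>z\<in>F. x \<in> ball z (L * \<rho> z)" if x: "x \<in> ball x0 r" for x
    proof (cases "x \<in> F")
      case True
      thus ?thesis using pos[of x] M by (intro bexI[of _ x]) (auto simp: L_def)
    next
      case False
      have "\<not> adf (insert x F)"
        using maxF[of "insert x F"] False F by (auto simp: adf_def)
      hence "\<exists>z\<in>F. ball x (\<rho> x) \<inter> ball z (\<rho> z) \<noteq> {}"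
        using F x False unfolding adf_def by (auto simp: disjoint_family_on_insert)
      then obtain z w where z: "z \<in> F" and "dist x w < \<rho> x" "dist z w < \<rho> z" by auto
      hence d: "dist z x < \<rho> z + \<rho> x"
        using dist_triangle[of z x w] by (simp add: dist_commute)
      \<comment> \<open>The larger of the two radii controls the distance, so they are comparable.\<close>
      have "\<rho> x \<le> M * \<rho> z"
        using cmp[of x z] cmp[of z x] d by (cases "\<rho> x \<le> \<rho> z") (auto simp: dist_commute)
      moreover have "0 < M * \<rho> z" using M pos[of z] by simp
      moreover have "L * \<rho> z = \<rho> z + 2 * (M * \<rho> z)" by (simp add: L_def algebra_simps)
      ultimately have "dist z x < L * \<rho> z" using d by linarith
      with z show ?thesis by auto
    qed
    show ?thesis
    proof (intro exI[of _ F] conjI subsetI)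
      show "finite F" using F by (simp add: adf_def)
      show "x \<in> (\<Union>z\<in>F. ball z (L * \<rho> z))" if "x \<in> ball x0 r" for x
        using covered[OF that] by simp
    qed (rule sum_le[OF F])
  qed
  have "0 < L" using M by (simp add: L_def)
  thus ?thesis
    by (intro exI[of _ L] exI[of _ c] conjI c allI impI cover)
qed

section \<open>Functions of bounded lower oscillation\<close>

lemma L1_loc_measurable:
  assumes f: "f \<in> L1_loc \<mu>"
  shows "f \<in> borel_measurable \<mu>"
proof (rule borel_measurable_LIMSEQ_real)
  fix x :: 'a
  obtain n0 :: nat where n0: "dist undefined x < real n0" using reals_Archimedean2 by blast
  have "eventually (\<lambda>n. indicator (ball undefined (real (Suc n))) x * f x = f x) sequentially"
    using n0 by (intro eventually_sequentiallyI[of n0]) (auto simp: indicator_def)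
  thus "(\<lambda>n. indicator (ball undefined (real (Suc n))) x * f x) \<longlonglongrightarrow> f x"
    by (rule tendsto_eventually)
next
  fix n
  have "set_integrable \<mu> (ball undefined (real (Suc n))) f" using f by (simp add: L1_loc_def)
  thus "(\<lambda>x. indicator (ball undefined (real (Suc n))) x * f x) \<in> borel_measurable \<mu>"
    by (simp add: set_integrable_def)
qed

text \<open>The essential infimum is the greatest lower bound valid almost everywhere, so replacing it by
  another lower bound \<open>a\<close> can only increase the oscillation.\<close>

lemma lower_osc_le:
  assumes g [measurable]: "g \<in> borel_measurable \<mu>" and r: "0 < r"
    and ge: "AE y in \<mu>. y \<in> ball x r \<longrightarrow> a \<le> g y"
    and int: "(\<integral>\<^sup>+y\<in>ball x r. ennreal (g y - a) \<partial>\<mu>) \<le> c * emeasure \<mu> (ball x r)"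
  shows "lower_osc \<mu> (ball x r) g \<le> c"
proof -
  have "esssup (restrict_space \<mu> (ball x r)) (\<lambda>y. - ereal (g y)) \<le> - ereal a"
  proof (rule esssup_I)
    show "(\<lambda>y. - ereal (g y)) \<in> borel_measurable (restrict_space \<mu> (ball x r))"
      by (rule measurable_restrict_space1) measurable
    show "AE y in restrict_space \<mu> (ball x r). - ereal (g y) \<le> - ereal a"
      using ge by (simp add: AE_restrict_space_iff space_eq)
  qed
  hence essinf: "ereal a \<le> essinf_on \<mu> (ball x r) g"
    unfolding essinf_on_def by (metis ereal_minus_le_minus ereal_uminus_uminus)
  have "e2ennreal (ereal (g y) - essinf_on \<mu> (ball x r) g) \<le> ennreal (g y - a)" for y
  proof -
    have "ereal (g y) - essinf_on \<mu> (ball x r) g \<le> ereal (g y) - ereal a"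
      using essinf by (intro ereal_minus_mono) auto
    from e2ennreal_mono[OF this] show ?thesis by simp
  qed
  hence "(\<integral>\<^sup>+y\<in>ball x r. e2ennreal (ereal (g y) - essinf_on \<mu> (ball x r) g) \<partial>\<mu>)
      \<le> (\<integral>\<^sup>+y\<in>ball x r. ennreal (g y - a) \<partial>\<mu>)"
    by (intro nn_integral_mono) (auto simp: indicator_def)
  with int have "(\<integral>\<^sup>+y\<in>ball x r. e2ennreal (ereal (g y) - essinf_on \<mu> (ball x r) g) \<partial>\<mu>)
      \<le> emeasure \<mu> (ball x r) * c" by (simp add: mult.commute)
  thus ?thesis unfolding lower_osc_def
    using emeasure_ball[OF r, of x] by (intro divide_le_posI_ennreal) auto
qed

text \<open>Extracts the real number \<open>essinf_on\<close> from the extended-real definitions.  The value \<open>\<infinity>\<close> is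
  excluded because balls have positive measure, and \<open>-\<infinity>\<close> because it would make the oscillation
  infinite.\<close>

lemma BLO_ball:
  assumes f: "f \<in> BLO \<mu>" and r: "0 < r"
  obtains m :: real where "AE y in \<mu>. y \<in> ball x r \<longrightarrow> m \<le> f y"
    and "(\<integral>\<^sup>+y\<in>ball x r. ennreal (f y - m) \<partial>\<mu>) \<le> BLO_norm \<mu> f * emeasure \<mu> (ball x r)"
proof -
  let ?B = "ball x r" and ?E = "essinf_on \<mu> (ball x r) f"
  have fin: "BLO_norm \<mu> f < \<infinity>" and [measurable]: "f \<in> borel_measurable \<mu>"
    using f L1_loc_measurable by (auto simp: BLO_def)
  note eB = emeasure_ball[OF r, of x]
  have osc: "lower_osc \<mu> ?B f \<le> BLO_norm \<mu> f"
    unfolding BLO_norm_def using r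
    by (intro SUP_upper2[where i="(x, r)"]) (auto simp: balls_def)
  have int: "(\<integral>\<^sup>+y\<in>?B. e2ennreal (ereal (f y) - ?E) \<partial>\<mu>) \<le> BLO_norm \<mu> f * emeasure \<mu> ?B"
  proof -
    have "(\<integral>\<^sup>+y\<in>?B. e2ennreal (ereal (f y) - ?E) \<partial>\<mu>) = lower_osc \<mu> ?B f * emeasure \<mu> ?B"
      using eB ennreal_divide_self[of "emeasure \<mu> ?B"]
      by (simp add: lower_osc_def ennreal_divide_times zero_less_iff_neq_zero)
    with mult_right_mono[OF osc, of "emeasure \<mu> ?B"] show ?thesis by simp
  qed
  have AE: "AE y in \<mu>. y \<in> ?B \<longrightarrow> ?E \<le> ereal (f y)"
  proof -
    have "AE y in restrict_space \<mu> ?B. ?E \<le> ereal (f y)"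
      using esssup_AE[of "\<lambda>y. - ereal (f y)" "restrict_space \<mu> ?B"]
      unfolding essinf_on_def by eventually_elim (simp add: ereal_uminus_le_reorder)
    thus ?thesis by (simp add: AE_restrict_space_iff space_eq)
  qed
  have "?E \<noteq> \<infinity>"
  proof
    assume "?E = \<infinity>"
    with AE have "AE y in \<mu>. y \<notin> ?B" by simp
    hence "emeasure \<mu> ?B = 0"
      by (subst (asm) AE_iff_measurable[of ?B]) (auto simp: space_eq)
    with eB show False by simp
  qed
  moreover have "?E \<noteq> -\<infinity>"
  proof
    assume "?E = -\<infinity>"
    hence "(\<integral>\<^sup>+y\<in>?B. e2ennreal (ereal (f y) - ?E) \<partial>\<mu>) = (\<integral>\<^sup>+y\<in>?B. \<infinity> \<partial>\<mu>)" by simp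
    also have "\<dots> = \<infinity> * emeasure \<mu> ?B" by (rule nn_integral_cmult_indicator) simp
    also have "\<dots> = \<infinity>" using eB by (simp add: ennreal_top_mult zero_less_iff_neq_zero)
    finally have "BLO_norm \<mu> f * emeasure \<mu> ?B = \<infinity>" using int by (simp add: top_unique)
    thus False using fin eB by (auto simp: ennreal_mult_eq_top_iff)
  qed
  ultimately obtain m where m: "?E = ereal m" by (cases ?E) auto
  show thesis using that[of m] AE int m by simp
qed

end

section \<open>Averaging kernels at the critical scale\<close>

text \<open>The one-sided consequences of the kernel conditions on which the argument rests: each section
  \<open>K x\<close> is a probability density concentrated at scale \<open>\<rho> x\<close> around \<open>x\<close>.\<close>

locale critical_kernel = doubling_measure \<mu> for \<mu> :: "'a::metric_space measure" +
  fixes \<rho> :: "'a \<Rightarrow> real" and K :: "'a \<Rightarrow> 'a \<Rightarrow> real" and C5 :: real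
  assumes adm: "admissible \<rho>"
    and K_nonneg: "0 \<le> K x y"
    and K_measurable: "(\<lambda>(x, y). K x y) \<in> borel_measurable (\<mu> \<Otimes>\<^sub>M \<mu>)"
    and C5: "0 < C5"
    and K_support: "C5 * \<rho> x < dist x y \<Longrightarrow> K x y = 0"
    and K_le: "K x y \<le> C5 / measure \<mu> (ball x (\<rho> x))"
    and K_integral: "(\<integral>y. K x y \<partial>\<mu>) = 1"
begin

lemma radius_pos: "0 < \<rho> x"
  using admissible_pos[OF adm] .

lemma K_section_measurable [measurable]: "K x \<in> borel_measurable \<mu>"
  using measurable_Pair2[OF K_measurable, of x] by (simp add: space_eq)

lemma K_integrable: "integrable \<mu> (K x)"
  using K_integral[of x] not_integrable_integral_eq[of \<mu> "K x"] by fastforce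

lemma kernel_op_measurable:
  assumes [measurable]: "f \<in> borel_measurable \<mu>"
  shows "kernel_op \<mu> K f \<in> borel_measurable \<mu>"
proof -
  interpret sigma_finite_measure \<mu> by (rule sigma_finite)
  note [measurable] = K_measurable
  have "(\<lambda>(x, y). K x y * f y) \<in> borel_measurable (\<mu> \<Otimes>\<^sub>M \<mu>)" by measurable
  from borel_measurable_lebesgue_integral[OF this] show ?thesis
    by (simp add: kernel_op_def[abs_def])
qed

text \<open>The witness for \<open>m\<close> is the essential infimum of \<open>f\<close> on the larger ball \<open>B\<close> of radius
  \<open>R * \<rho> z\<close>, which contains the supports of all \<open>K x\<close> at once.  Since \<open>K x\<close> has mass one and
  \<open>f - m\<close> is non-negative on \<open>B\<close>, the bound \<open>K x \<le> const / \<mu>(B)\<close> controls \<open>Kf - m\<close> by the mean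
  of \<open>f - m\<close> on \<open>B\<close>.\<close>

lemma kernel_op_near_essinf:
  assumes L: "0 < L"
  shows "\<exists>c\<ge>1. \<forall>f\<in>BLO \<mu>. \<forall>z. \<exists>m.
    (AE y in \<mu>. y \<in> ball z (L * \<rho> z) \<longrightarrow> m \<le> f y) \<and>
    (\<integral>\<^sup>+y\<in>ball z (L * \<rho> z). ennreal (f y - m) \<partial>\<mu>)
      \<le> ennreal c * BLO_norm \<mu> f * emeasure \<mu> (ball z (\<rho> z)) \<and>
    (\<forall>x\<in>ball z (L * \<rho> z).
       m \<le> kernel_op \<mu> K f x \<and> ennreal (kernel_op \<mu> K f x - m) \<le> ennreal c * BLO_norm \<mu> f)"
proof -
  obtain M where M: "M \<ge> 1"
    and cmp: "\<And>z x. dist z x \<le> L * \<rho> z \<Longrightarrow> \<rho> z \<le> M * \<rho> x \<and> \<rho> x \<le> M * \<rho> z"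
    using admissible_comparable[OF adm, of L] by blast
  \<comment> \<open>If \<open>x\<close> is within \<open>L * \<rho> z\<close> of \<open>z\<close>, then \<open>\<rho> x \<le> M * \<rho> z\<close> and the support of \<open>K x\<close> reaches
      no further than \<open>C5 * M * \<rho> z\<close> from \<open>x\<close>.\<close>
  define R where "R = L + C5 * M"
  have C5M: "0 < C5 * M" using C5 M by simp
  hence R: "L < R" "0 < R" using L by (simp_all add: R_def)
  \<comment> \<open>\<open>c1\<close> compares the enclosing ball with \<open>ball x (\<rho> x)\<close>, for the kernel bound; \<open>c2\<close> compares it
      with \<open>ball z (\<rho> z)\<close>.\<close>
  obtain c1 where c1: "c1 \<ge> 1"
    and dil1: "\<And>x y r s. 0 < r \<Longrightarrow> ball x s \<subseteq> ball y ((L + R) * M * r) \<Longrightarrow>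
        measure \<mu> (ball x s) \<le> c1 * measure \<mu> (ball y r)"
    using measure_ball_dilation[of "(L + R) * M"] by blast
  obtain c2 where c2: "c2 \<ge> 1"
    and dil2: "\<And>x y r s. 0 < r \<Longrightarrow> ball x s \<subseteq> ball y (R * r) \<Longrightarrow>
        measure \<mu> (ball x s) \<le> c2 * measure \<mu> (ball y r)"
    using measure_ball_dilation[of R] by blast
  define c where "c = max c2 (C5 * c1)"
  have "\<exists>m. (AE y in \<mu>. y \<in> ball z (L * \<rho> z) \<longrightarrow> m \<le> f y) \<and>
    (\<integral>\<^sup>+y\<in>ball z (L * \<rho> z). ennreal (f y - m) \<partial>\<mu>)
      \<le> ennreal c * BLO_norm \<mu> f * emeasure \<mu> (ball z (\<rho> z)) \<and>
    (\<forall>x\<in>ball z (L * \<rho> z).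
       m \<le> kernel_op \<mu> K f x \<and> ennreal (kernel_op \<mu> K f x - m) \<le> ennreal c * BLO_norm \<mu> f)"
    if f: "f \<in> BLO \<mu>" for f z
  proof -
    define B where "B = ball z (R * \<rho> z)"
    have B_sets [measurable]: "B \<in> sets \<mu>" by (simp add: B_def)
    have f_L1: "f \<in> L1_loc \<mu>" using f by (simp add: BLO_def)
    note [measurable] = L1_loc_measurable[OF f_L1]
    have R\<rho>: "0 < R * \<rho> z" using R radius_pos[of z] by simp
    have mB: "0 < measure \<mu> B" unfolding B_def using R\<rho> by (rule measure_ball_pos)
    obtain m where AE_m: "AE y in \<mu>. y \<in> B \<longrightarrow> m \<le> f y"
      and int_m: "(\<integral>\<^sup>+y\<in>B. ennreal (f y - m) \<partial>\<mu>) \<le> BLO_norm \<mu> f * emeasure \<mu> B"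
      using BLO_ball[OF f R\<rho>, of z] unfolding B_def by blast
    have sub: "ball z (L * \<rho> z) \<subseteq> B"
      unfolding B_def using R radius_pos[of z] by (intro ball_subset_ballI) auto
    have eB: "emeasure \<mu> B \<le> ennreal c * emeasure \<mu> (ball z (\<rho> z))"
    proof -
      have "measure \<mu> B \<le> c2 * measure \<mu> (ball z (\<rho> z))"
        unfolding B_def by (intro dil2 radius_pos) simp
      also have "\<dots> \<le> c * measure \<mu> (ball z (\<rho> z))"
        by (intro mult_right_mono) (auto simp: c_def)
      finally show ?thesis using c2
        by (simp add: B_def emeasure_ball_eq c_def ennreal_mult[symmetric] ennreal_leI)
    qed
    have "AE y in \<mu>. y \<in> ball z (L * \<rho> z) \<longrightarrow> m \<le> f y"
      using AE_m sub by (auto elim!: eventually_mono)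
    moreover have "(\<integral>\<^sup>+y\<in>ball z (L * \<rho> z). ennreal (f y - m) \<partial>\<mu>)
      \<le> ennreal c * BLO_norm \<mu> f * emeasure \<mu> (ball z (\<rho> z))"
    proof -
      have "(\<integral>\<^sup>+y\<in>ball z (L * \<rho> z). ennreal (f y - m) \<partial>\<mu>) \<le> (\<integral>\<^sup>+y\<in>B. ennreal (f y - m) \<partial>\<mu>)"
        using sub by (rule nn_set_integral_set_mono)
      also note int_m
      also have "BLO_norm \<mu> f * emeasure \<mu> B
          \<le> BLO_norm \<mu> f * (ennreal c * emeasure \<mu> (ball z (\<rho> z)))"
        using eB by (rule mult_left_mono) simp
      finally show ?thesis by (simp add: ac_simps)
    qed
    moreover have "m \<le> kernel_op \<mu> K f x \<and> ennreal (kernel_op \<mu> K f x - m) \<le> ennreal c * BLO_norm \<mu> f"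
      if x: "x \<in> ball z (L * \<rho> z)" for x
    proof -
      have \<rho>x: "\<rho> z \<le> M * \<rho> x" "\<rho> x \<le> M * \<rho> z" using cmp[of z x] x by auto
      have supp: "K x y = 0" if "y \<notin> B" for y
      proof (rule K_support, rule ccontr)
        assume "\<not> C5 * \<rho> x < dist x y"
        hence "dist x y \<le> C5 * (M * \<rho> z)"
          using mult_left_mono[OF \<rho>x(2), of C5] C5 by linarith
        hence "dist z y < R * \<rho> z"
          using x radius_pos[of z] dist_triangle[of z y x] by (simp add: R_def algebra_simps)
        with that show False by (simp add: B_def)
      qed
      define \<kappa> where "\<kappa> = C5 * c1 / measure \<mu> B"
      have bound: "K x y \<le> \<kappa>" for y
      proof -
        have "measure \<mu> B \<le> c1 * measure \<mu> (ball x (\<rho> x))"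
          unfolding B_def
        proof (intro dil1 radius_pos ball_subset_ballI)
          have "(L + R) * \<rho> z \<le> (L + R) * (M * \<rho> x)"
            using \<rho>x(1) L R by (intro mult_left_mono) auto
          thus "dist z x + R * \<rho> z \<le> (L + R) * M * \<rho> x"
            using x by (simp add: algebra_simps)
        qed
        hence "C5 / measure \<mu> (ball x (\<rho> x)) \<le> \<kappa>"
          using mB measure_ball_pos[OF radius_pos, of x x] C5
          by (simp add: \<kappa>_def field_simps)
        with K_le[of x y] show ?thesis by linarith
      qed
      have \<kappa>0: "0 \<le> \<kappa>" using bound[of x] K_nonneg[of x x] by linarith
      have int_Kf: "integrable \<mu> (\<lambda>y. K x y * f y)"
      proof (rule Bochner_Integration.integrable_bound)
        have "set_integrable \<mu> B f" using f_L1 R\<rho> by (simp add: L1_loc_def B_def)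
        thus "integrable \<mu> (\<lambda>y. \<kappa> * (indicator B y * f y))" by (simp add: set_integrable_def)
        show "AE y in \<mu>. norm (K x y * f y) \<le> norm (\<kappa> * (indicator B y * f y))"
        proof (rule AE_I2)
          fix y show "norm (K x y * f y) \<le> norm (\<kappa> * (indicator B y * f y))"
            using supp[of y] bound[of y] K_nonneg[of x y] \<kappa>0
            by (cases "y \<in> B") (auto simp: abs_mult intro!: mult_right_mono)
        qed
      qed measurable
      have int: "integrable \<mu> (\<lambda>y. K x y * (f y - m))"
        using int_Kf K_integrable[of x] by (simp add: right_diff_distrib)
      have eq: "kernel_op \<mu> K f x - m = (\<integral>y. K x y * (f y - m) \<partial>\<mu>)"
        using int_Kf K_integrable[of x] K_integral[of x]
        by (simp add: right_diff_distrib kernel_op_def)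
      have nn: "AE y in \<mu>. 0 \<le> K x y * (f y - m)"
        using AE_m supp K_nonneg[of x] by (auto elim!: eventually_mono)
      have "ennreal (kernel_op \<mu> K f x - m) = (\<integral>\<^sup>+y. ennreal (K x y * (f y - m)) \<partial>\<mu>)"
        unfolding eq by (rule nn_integral_eq_integral[symmetric, OF int nn])
      also have "\<dots> \<le> (\<integral>\<^sup>+y. ennreal \<kappa> * (ennreal (f y - m) * indicator B y) \<partial>\<mu>)"
      proof (rule nn_integral_mono)
        fix y
        have "ennreal (K x y * (f y - m)) = ennreal (K x y) * ennreal (f y - m)"
          using K_nonneg by (rule ennreal_mult')
        also have "\<dots> \<le> ennreal \<kappa> * (ennreal (f y - m) * indicator B y)"
          using supp[of y] bound[of y] by (cases "y \<in> B") (auto intro!: mult_right_mono ennreal_leI)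
        finally show "ennreal (K x y * (f y - m))
            \<le> ennreal \<kappa> * (ennreal (f y - m) * indicator B y)" .
      qed
      also have "\<dots> = ennreal \<kappa> * (\<integral>\<^sup>+y\<in>B. ennreal (f y - m) \<partial>\<mu>)"
        by (rule nn_integral_cmult) measurable
      also have "\<dots> \<le> ennreal \<kappa> * (BLO_norm \<mu> f * emeasure \<mu> B)"
        using int_m by (rule mult_left_mono) simp
      also have "\<dots> = ennreal (\<kappa> * measure \<mu> B) * BLO_norm \<mu> f"
        using \<kappa>0 by (simp add: B_def emeasure_ball_eq ennreal_mult ac_simps)
      also have "\<kappa> * measure \<mu> B = C5 * c1" using mB by (simp add: \<kappa>_def)
      also have "ennreal (C5 * c1) * BLO_norm \<mu> f \<le> ennreal c * BLO_norm \<mu> f"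
        by (intro mult_right_mono ennreal_leI) (auto simp: c_def)
      finally have "ennreal (kernel_op \<mu> K f x - m) \<le> ennreal c * BLO_norm \<mu> f" .
      moreover have "m \<le> kernel_op \<mu> K f x"
        using integral_nonneg_AE[OF nn] eq by linarith
      ultimately show ?thesis by blast
    qed
    ultimately show ?thesis by blast
  qed
  moreover have "1 \<le> c" using c2 by (simp add: c_def)
  ultimately show ?thesis by blast
qed

text \<open>On such a ball \<open>Kf\<close> stays within \<open>[m, m + c N]\<close>, so \<open>f - Kf\<close> is bounded below by the
  essential infimum of \<open>f\<close> minus \<open>m + c N\<close>, and exceeds this bound by at most \<open>c N\<close> more than
  \<open>f\<close> exceeds its own.\<close>

lemma lower_osc_small_ball:
  "\<exists>c\<ge>0. \<forall>f\<in>BLO \<mu>. \<forall>x r. 0 < r \<longrightarrow> r < \<rho> x \<longrightarrow>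
     lower_osc \<mu> (ball x r) (\<lambda>y. f y - kernel_op \<mu> K f y) \<le> ennreal c * BLO_norm \<mu> f"
proof -
  obtain c where c: "c \<ge> 1" and near: "\<And>f z. f \<in> BLO \<mu> \<Longrightarrow> \<exists>m. \<forall>x\<in>ball z (\<rho> z).
       m \<le> kernel_op \<mu> K f x \<and> ennreal (kernel_op \<mu> K f x - m) \<le> ennreal c * BLO_norm \<mu> f"
    using kernel_op_near_essinf[of 1] by fastforce
  have "lower_osc \<mu> (ball x r) (\<lambda>y. f y - kernel_op \<mu> K f y) \<le> ennreal (1 + c) * BLO_norm \<mu> f"
    if f: "f \<in> BLO \<mu>" and r: "0 < r" "r < \<rho> x" for f x r
  proof -
    have [measurable]: "f \<in> borel_measurable \<mu>"
      using f L1_loc_measurable by (auto simp: BLO_def)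
    note [measurable] = kernel_op_measurable[OF this]
    obtain n where n: "0 \<le> n" "BLO_norm \<mu> f = ennreal n"
      using f by (cases "BLO_norm \<mu> f") (auto simp: BLO_def)
    obtain m where m: "\<And>y. y \<in> ball x (\<rho> x) \<Longrightarrow>
        m \<le> kernel_op \<mu> K f y \<and> ennreal (kernel_op \<mu> K f y - m) \<le> ennreal c * BLO_norm \<mu> f"
      using near[OF f] by blast
    have m': "m \<le> kernel_op \<mu> K f y" "kernel_op \<mu> K f y \<le> m + c * n" if "y \<in> ball x r" for y
    proof -
      have y: "y \<in> ball x (\<rho> x)" using that r by auto
      show "m \<le> kernel_op \<mu> K f y" using m[OF y] by blast
      have "ennreal (kernel_op \<mu> K f y - m) \<le> ennreal (c * n)"
        using m[OF y] n c by (simp add: ennreal_mult)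
      thus "kernel_op \<mu> K f y \<le> m + c * n" using n c by (simp add: ennreal_le_iff)
    qed
    obtain mB where AE_mB: "AE y in \<mu>. y \<in> ball x r \<longrightarrow> mB \<le> f y"
      and int_mB: "(\<integral>\<^sup>+y\<in>ball x r. ennreal (f y - mB) \<partial>\<mu>) \<le> BLO_norm \<mu> f * emeasure \<mu> (ball x r)"
      using BLO_ball[OF f r(1), of x] by blast
    define a where "a = mB - m - c * n"
    show ?thesis
    proof (rule lower_osc_le[OF _ r(1)])
      show "(\<lambda>y. f y - kernel_op \<mu> K f y) \<in> borel_measurable \<mu>" by measurable
      show "AE y in \<mu>. y \<in> ball x r \<longrightarrow> a \<le> f y - kernel_op \<mu> K f y"
        using AE_mB by eventually_elim (use m' in \<open>fastforce simp: a_def\<close>)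
      have "(\<integral>\<^sup>+y\<in>ball x r. ennreal (f y - kernel_op \<mu> K f y - a) \<partial>\<mu>)
          \<le> (\<integral>\<^sup>+y. ennreal (f y - mB) * indicator (ball x r) y
                  + ennreal (c * n) * indicator (ball x r) y \<partial>\<mu>)"
      proof (rule nn_integral_mono_AE, use AE_mB in eventually_elim)
        fix y assume ge: "y \<in> ball x r \<longrightarrow> mB \<le> f y"
        show "ennreal (f y - kernel_op \<mu> K f y - a) * indicator (ball x r) y
          \<le> ennreal (f y - mB) * indicator (ball x r) y + ennreal (c * n) * indicator (ball x r) y"
        proof (cases "y \<in> ball x r")
          case True
          have "ennreal (f y - kernel_op \<mu> K f y - a) \<le> ennreal (f y - mB + c * n)"
            using m'[OF True] by (intro ennreal_leI) (simp add: a_def)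
          thus ?thesis using True ge n c by (simp add: ennreal_plus)
        qed simp
      qed
      also have "\<dots> = (\<integral>\<^sup>+y\<in>ball x r. ennreal (f y - mB) \<partial>\<mu>) + ennreal (c * n) * emeasure \<mu> (ball x r)"
        by (subst nn_integral_add) (auto simp: nn_integral_cmult_indicator)
      also have "\<dots> \<le> BLO_norm \<mu> f * emeasure \<mu> (ball x r) + ennreal (c * n) * emeasure \<mu> (ball x r)"
        using int_mB by (rule add_right_mono)
      also have "\<dots> = ennreal (1 + c) * BLO_norm \<mu> f * emeasure \<mu> (ball x r)"
        using n c by (simp add: ennreal_plus ennreal_mult distrib_right)
      finally show "(\<integral>\<^sup>+y\<in>ball x r. ennreal (f y - kernel_op \<mu> K f y - a) \<partial>\<mu>)
          \<le> ennreal (1 + c) * BLO_norm \<mu> f * emeasure \<mu> (ball x r)" .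
    qed
  qed
  moreover have "0 \<le> 1 + c" using c by simp
  ultimately show ?thesis by blast
qed

lemma critical_ball_integral:
  assumes L: "0 < L"
  shows "\<exists>c\<ge>0. \<forall>f\<in>BLO \<mu>. \<forall>z.
    (\<integral>\<^sup>+y\<in>ball z (L * \<rho> z). ennreal \<bar>f y - kernel_op \<mu> K f y\<bar> \<partial>\<mu>)
      \<le> ennreal c * BLO_norm \<mu> f * emeasure \<mu> (ball z (\<rho> z))"
proof -
  obtain c where c: "c \<ge> 1" and near: "\<And>f z. f \<in> BLO \<mu> \<Longrightarrow> \<exists>m.
    (AE y in \<mu>. y \<in> ball z (L * \<rho> z) \<longrightarrow> m \<le> f y) \<and>
    (\<integral>\<^sup>+y\<in>ball z (L * \<rho> z). ennreal (f y - m) \<partial>\<mu>)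
      \<le> ennreal c * BLO_norm \<mu> f * emeasure \<mu> (ball z (\<rho> z)) \<and>
    (\<forall>x\<in>ball z (L * \<rho> z).
       m \<le> kernel_op \<mu> K f x \<and> ennreal (kernel_op \<mu> K f x - m) \<le> ennreal c * BLO_norm \<mu> f)"
    using kernel_op_near_essinf[OF L] by blast
  obtain d where d: "d \<ge> 1"
    and dil: "\<And>x y r s. 0 < r \<Longrightarrow> ball x s \<subseteq> ball y (L * r) \<Longrightarrow>
        measure \<mu> (ball x s) \<le> d * measure \<mu> (ball y r)"
    using measure_ball_dilation[of L] by blast
  have "(\<integral>\<^sup>+y\<in>ball z (L * \<rho> z). ennreal \<bar>f y - kernel_op \<mu> K f y\<bar> \<partial>\<mu>)
      \<le> ennreal (c * (1 + d)) * BLO_norm \<mu> f * emeasure \<mu> (ball z (\<rho> z))"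
    if f: "f \<in> BLO \<mu>" for f z
  proof -
    let ?B = "ball z (L * \<rho> z)" and ?N = "BLO_norm \<mu> f"
    have [measurable]: "f \<in> borel_measurable \<mu>"
      using f L1_loc_measurable by (auto simp: BLO_def)
    obtain m where AE_m: "AE y in \<mu>. y \<in> ?B \<longrightarrow> m \<le> f y"
      and int_m: "(\<integral>\<^sup>+y\<in>?B. ennreal (f y - m) \<partial>\<mu>) \<le> ennreal c * ?N * emeasure \<mu> (ball z (\<rho> z))"
      and Kf: "\<And>y. y \<in> ?B \<Longrightarrow>
        m \<le> kernel_op \<mu> K f y \<and> ennreal (kernel_op \<mu> K f y - m) \<le> ennreal c * ?N"
      using near[OF f, of z] by blast
    have "(\<integral>\<^sup>+y\<in>?B. ennreal \<bar>f y - kernel_op \<mu> K f y\<bar> \<partial>\<mu>)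
        \<le> (\<integral>\<^sup>+y. ennreal (f y - m) * indicator ?B y + ennreal c * ?N * indicator ?B y \<partial>\<mu>)"
    proof (rule nn_integral_mono_AE, use AE_m in eventually_elim)
      fix y assume ge: "y \<in> ?B \<longrightarrow> m \<le> f y"
      show "ennreal \<bar>f y - kernel_op \<mu> K f y\<bar> * indicator ?B y
        \<le> ennreal (f y - m) * indicator ?B y + ennreal c * ?N * indicator ?B y"
      proof (cases "y \<in> ?B")
        case True
        have "ennreal \<bar>f y - kernel_op \<mu> K f y\<bar> \<le> ennreal ((f y - m) + (kernel_op \<mu> K f y - m))"
          using Kf[OF True] ge True by (intro ennreal_leI) auto
        also have "\<dots> = ennreal (f y - m) + ennreal (kernel_op \<mu> K f y - m)"
          using Kf[OF True] ge True by (intro ennreal_plus) auto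
        also have "\<dots> \<le> ennreal (f y - m) + ennreal c * ?N"
          using Kf[OF True] by (intro add_left_mono) blast
        finally show ?thesis using True by simp
      qed simp
    qed
    also have "\<dots> = (\<integral>\<^sup>+y\<in>?B. ennreal (f y - m) \<partial>\<mu>) + ennreal c * ?N * emeasure \<mu> ?B"
      by (subst nn_integral_add) (auto simp: nn_integral_cmult_indicator)
    also have "\<dots> \<le> ennreal c * ?N * emeasure \<mu> (ball z (\<rho> z))
        + ennreal c * ?N * (ennreal d * emeasure \<mu> (ball z (\<rho> z)))"
    proof (intro add_mono int_m mult_left_mono)
      have "measure \<mu> ?B \<le> d * measure \<mu> (ball z (\<rho> z))" by (intro dil radius_pos) simp
      thus "emeasure \<mu> ?B \<le> ennreal d * emeasure \<mu> (ball z (\<rho> z))"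
        using d by (simp add: emeasure_ball_eq ennreal_mult[symmetric] ennreal_leI)
    qed simp
    also have "\<dots> = ennreal (c * (1 + d)) * ?N * emeasure \<mu> (ball z (\<rho> z))"
      using c d by (simp add: ennreal_mult ennreal_plus algebra_simps)
    finally show ?thesis .
  qed
  moreover have "0 \<le> c * (1 + d)" using c d by simp
  ultimately show ?thesis by blast
qed

lemma large_ball_integral:
  "\<exists>c\<ge>0. \<forall>f\<in>BLO \<mu>. \<forall>x r. \<rho> x \<le> r \<longrightarrow>
     (\<integral>\<^sup>+y\<in>ball x r. ennreal \<bar>f y - kernel_op \<mu> K f y\<bar> \<partial>\<mu>)
       \<le> ennreal c * BLO_norm \<mu> f * emeasure \<mu> (ball x r)"
proof -
  obtain L where L: "0 < L" and ex_d: "\<exists>d\<ge>1. \<forall>x r. \<rho> x \<le> r \<longrightarrow>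
    (\<exists>F. finite F \<and> ball x r \<subseteq> (\<Union>z\<in>F. ball z (L * \<rho> z)) \<and>
         (\<Sum>z\<in>F. measure \<mu> (ball z (\<rho> z))) \<le> d * measure \<mu> (ball x r))"
    using critical_covering[OF adm] by blast
  from ex_d obtain d where d: "1 \<le> d" and cover: "\<And>x r. \<rho> x \<le> r \<Longrightarrow>
    \<exists>F. finite F \<and> ball x r \<subseteq> (\<Union>z\<in>F. ball z (L * \<rho> z)) \<and>
         (\<Sum>z\<in>F. measure \<mu> (ball z (\<rho> z))) \<le> d * measure \<mu> (ball x r)"
    by (elim exE conjE) simp
  obtain c where c: "0 \<le> c" and crit: "\<And>f z. f \<in> BLO \<mu> \<Longrightarrow>
    (\<integral>\<^sup>+y\<in>ball z (L * \<rho> z). ennreal \<bar>f y - kernel_op \<mu> K f y\<bar> \<partial>\<mu>)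
      \<le> ennreal c * BLO_norm \<mu> f * emeasure \<mu> (ball z (\<rho> z))"
    using critical_ball_integral[OF L] by blast
  have "(\<integral>\<^sup>+y\<in>ball x r. ennreal \<bar>f y - kernel_op \<mu> K f y\<bar> \<partial>\<mu>)
       \<le> ennreal (c * d) * BLO_norm \<mu> f * emeasure \<mu> (ball x r)"
    if f: "f \<in> BLO \<mu>" and r: "\<rho> x \<le> r" for f x r
  proof -
    let ?g = "\<lambda>y. ennreal \<bar>f y - kernel_op \<mu> K f y\<bar>"
    have [measurable]: "f \<in> borel_measurable \<mu>"
      using f L1_loc_measurable by (auto simp: BLO_def)
    note [measurable] = kernel_op_measurable[OF this]
    obtain F where F: "finite F" "ball x r \<subseteq> (\<Union>z\<in>F. ball z (L * \<rho> z))"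
      and sum: "(\<Sum>z\<in>F. measure \<mu> (ball z (\<rho> z))) \<le> d * measure \<mu> (ball x r)"
      using cover[OF r] by blast
    have "(\<integral>\<^sup>+y\<in>ball x r. ?g y \<partial>\<mu>) \<le> (\<integral>\<^sup>+y. (\<Sum>z\<in>F. ?g y * indicator (ball z (L * \<rho> z)) y) \<partial>\<mu>)"
    proof (rule nn_integral_mono)
      fix y
      show "?g y * indicator (ball x r) y \<le> (\<Sum>z\<in>F. ?g y * indicator (ball z (L * \<rho> z)) y)"
      proof (cases "y \<in> ball x r")
        case True
        then obtain z where z: "z \<in> F" "y \<in> ball z (L * \<rho> z)" using F(2) by blast
        have "?g y * indicator (ball z (L * \<rho> z)) y \<le> (\<Sum>z\<in>F. ?g y * indicator (ball z (L * \<rho> z)) y)"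
          using z(1) F(1) by (intro member_le_sum) auto
        thus ?thesis using True z(2) by simp
      qed simp
    qed
    also have "\<dots> = (\<Sum>z\<in>F. \<integral>\<^sup>+y\<in>ball z (L * \<rho> z). ?g y \<partial>\<mu>)"
      by (rule nn_integral_sum) measurable
    also have "\<dots> \<le> (\<Sum>z\<in>F. ennreal c * BLO_norm \<mu> f * emeasure \<mu> (ball z (\<rho> z)))"
      by (intro sum_mono crit f)
    also have "\<dots> = ennreal c * BLO_norm \<mu> f * ennreal (\<Sum>z\<in>F. measure \<mu> (ball z (\<rho> z)))"
      by (simp add: emeasure_ball_eq sum_distrib_left[symmetric])
    also have "\<dots> \<le> ennreal c * BLO_norm \<mu> f * ennreal (d * measure \<mu> (ball x r))"
      using sum by (intro mult_left_mono ennreal_leI) auto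
    also have "\<dots> = ennreal (c * d) * BLO_norm \<mu> f * emeasure \<mu> (ball x r)"
      using c d by (simp add: emeasure_ball_eq ennreal_mult ac_simps)
    finally show ?thesis .
  qed
  moreover have "0 \<le> c * d" using c d by simp
  ultimately show ?thesis by blast
qed

lemma BLO_minus_kernel_op:
  "\<exists>C>0. \<forall>f\<in>BLO \<mu>.
     (\<lambda>x. f x - kernel_op \<mu> K f x) \<in> BLO_rho \<mu> \<rho> \<and>
     BLO_rho_norm \<mu> \<rho> (\<lambda>x. f x - kernel_op \<mu> K f x) \<le> ennreal C * BLO_norm \<mu> f"
proof -
  obtain a where a: "0 \<le> a" and small: "\<And>f x r. f \<in> BLO \<mu> \<Longrightarrow> 0 < r \<Longrightarrow> r < \<rho> x \<Longrightarrow>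
     lower_osc \<mu> (ball x r) (\<lambda>y. f y - kernel_op \<mu> K f y) \<le> ennreal a * BLO_norm \<mu> f"
    using lower_osc_small_ball by blast
  obtain b where b: "0 \<le> b" and large: "\<And>f x r. f \<in> BLO \<mu> \<Longrightarrow> \<rho> x \<le> r \<Longrightarrow>
     (\<integral>\<^sup>+y\<in>ball x r. ennreal \<bar>f y - kernel_op \<mu> K f y\<bar> \<partial>\<mu>)
       \<le> ennreal b * BLO_norm \<mu> f * emeasure \<mu> (ball x r)"
    using large_ball_integral by blast
  define C where "C = a + b + 1"
  have "(\<lambda>x. f x - kernel_op \<mu> K f x) \<in> BLO_rho \<mu> \<rho> \<and>
     BLO_rho_norm \<mu> \<rho> (\<lambda>x. f x - kernel_op \<mu> K f x) \<le> ennreal C * BLO_norm \<mu> f"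
    if f: "f \<in> BLO \<mu>" for f
  proof -
    let ?g = "\<lambda>x. f x - kernel_op \<mu> K f x"
    have [measurable]: "f \<in> borel_measurable \<mu>"
      using f L1_loc_measurable by (auto simp: BLO_def)
    note [measurable] = kernel_op_measurable[OF this]
    have fin: "BLO_norm \<mu> f < \<infinity>" using f by (simp add: BLO_def)
    have "(SUP (x, r)\<in>balls - large_balls \<rho>. lower_osc \<mu> (ball x r) ?g) \<le> ennreal a * BLO_norm \<mu> f"
      by (rule SUP_least) (auto simp: balls_def large_balls_def intro!: small[OF f])
    moreover have "(SUP (x, r)\<in>large_balls \<rho>. mean_abs \<mu> (ball x r) ?g) \<le> ennreal b * BLO_norm \<mu> f"
    proof (rule SUP_least, clarsimp simp: balls_def large_balls_def)
      fix x r assume r: "\<rho> x \<le> r" "0 < r"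
      show "mean_abs \<mu> (ball x r) ?g \<le> ennreal b * BLO_norm \<mu> f"
        unfolding mean_abs_def using large[OF f r(1)] emeasure_ball[OF r(2), of x]
        by (intro divide_le_posI_ennreal) (auto simp: mult.commute)
    qed
    ultimately have "BLO_rho_norm \<mu> \<rho> ?g \<le> ennreal a * BLO_norm \<mu> f + ennreal b * BLO_norm \<mu> f"
      unfolding BLO_rho_norm_def by (rule add_mono)
    also have "\<dots> = ennreal (a + b) * BLO_norm \<mu> f"
      using a b by (simp add: ennreal_plus distrib_right)
    also have "\<dots> \<le> ennreal C * BLO_norm \<mu> f"
      by (intro mult_right_mono ennreal_leI) (auto simp: C_def)
    finally have norm: "BLO_rho_norm \<mu> \<rho> ?g \<le> ennreal C * BLO_norm \<mu> f" .
    have "set_integrable \<mu> (ball x r) ?g" for x r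
    proof -
      \<comment> \<open>Every ball lies in a large ball with the same centre.\<close>
      have "set_integrable \<mu> (ball x (max r (\<rho> x))) ?g"
        unfolding set_integrable_def
      proof (rule integrableI_bounded)
        have "(\<integral>\<^sup>+y. ennreal (norm (indicator (ball x (max r (\<rho> x))) y *\<^sub>R ?g y)) \<partial>\<mu>)
            = (\<integral>\<^sup>+y\<in>ball x (max r (\<rho> x)). ennreal \<bar>?g y\<bar> \<partial>\<mu>)"
          by (intro nn_integral_cong) (simp add: indicator_def)
        also have "\<dots> \<le> ennreal b * BLO_norm \<mu> f * emeasure \<mu> (ball x (max r (\<rho> x)))"
          by (rule large[OF f]) simp
        also have "\<dots> < \<infinity>"
          using fin by (simp add: emeasure_ball_eq ennreal_mult_less_top)
        finally show "(\<integral>\<^sup>+y. ennreal (norm (indicator (ball x (max r (\<rho> x))) y *\<^sub>R ?g y)) \<partial>\<mu>) < \<infinity>" .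
      qed measurable
      thus ?thesis by (rule set_integrable_subset) auto
    qed
    moreover have "ennreal C * BLO_norm \<mu> f < \<infinity>" using fin by (simp add: ennreal_mult_less_top)
    ultimately show ?thesis using norm unfolding BLO_rho_def L1_loc_def by auto
  qed
  moreover have "0 < C" using a b by (simp add: C_def)
  ultimately show ?thesis by blast
qed

end

section \<open>Boundedness from BLO to its localized version\<close>

theorem theorem3p3:
  fixes \<mu> :: "'a::metric_space measure"
    and \<rho> :: "'a \<Rightarrow> real"
    and K :: "'a \<Rightarrow> 'a \<Rightarrow> real"
    and C5 :: real
  assumes RD: "RD_space \<mu>"
    and rho: "admissible \<rho>"
    and K_nonneg: "\<And>x y. 0 \<le> K x y"
    and K_measurable: "(\<lambda>(x, y). K x y) \<in> borel_measurable (\<mu> \<Otimes>\<^sub>M \<mu>)"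
    and C5: "0 < C5"
    and K1: "\<And>x y. dist x y > C5 * min (\<rho> x) (\<rho> y) \<Longrightarrow> K x y = 0"
    and K2: "\<And>x y. K x y \<le> C5 * (1 / (measure \<mu> (ball x (\<rho> x)) + measure \<mu> (ball y (\<rho> y))))"
    and K3: "\<And>x y. K x y = K y x"
    and K4: "\<And>y. (\<integral>x. K x y \<partial>\<mu>) = 1"
  shows "\<exists>C>0. \<forall>f\<in>BLO \<mu>.
           (\<lambda>x. f x - kernel_op \<mu> K f x) \<in> BLO_rho \<mu> \<rho> \<and>
           BLO_rho_norm \<mu> \<rho> (\<lambda>x. f x - kernel_op \<mu> K f x) \<le> ennreal C * BLO_norm \<mu> f"
proof -
  interpret doubling_measure \<mu>
    using RD by unfold_locales (auto simp: RD_space_def regular_borel_measure_def)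
  interpret critical_kernel \<mu> \<rho> K C5
  proof
    fix x y
    show "K x y = 0" if "C5 * \<rho> x < dist x y"
    proof (rule K1)
      have "C5 * min (\<rho> x) (\<rho> y) \<le> C5 * \<rho> x" using C5 by (intro mult_left_mono) auto
      with that show "C5 * min (\<rho> x) (\<rho> y) < dist x y" by linarith
    qed
    have "C5 * (1 / (measure \<mu> (ball x (\<rho> x)) + measure \<mu> (ball y (\<rho> y))))
        \<le> C5 * (1 / measure \<mu> (ball x (\<rho> x)))"
      using C5 measure_ball_pos[OF admissible_pos[OF rho], of x x]
      by (intro mult_left_mono divide_left_mono) (auto intro!: mult_pos_pos add_pos_nonneg)
    with K2[of x y] show "K x y \<le> C5 / measure \<mu> (ball x (\<rho> x))" by simp
    show "(\<integral>y. K x y \<partial>\<mu>) = 1" using K4[of x] K3[of x] by simp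
  qed (use rho K_nonneg K_measurable C5 in auto)
  show ?thesis by (rule BLO_minus_kernel_op)
qed

end
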